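(* For every positive integer $m$ and every integer $k\ge 1$, $$\genfrac{[}{]}{0pt}{}{1/2+k}{k}_q \;\geq_q\; \genfrac{[}{]}{0pt}{}{m+k}{k}_q .$$
   Context: Let $\mathcal P=\bigcup_{b\ge 1}\mathbb{Q}[[q^{1/b}]]$ be the ring of Puiseux series over $\mathbb{Q}$ with nonnegative exponents (formal series in $q$ whose exponents are nonnegative rationals admitting a common denominator). For $A(q)=\sum_{\alpha\in\mathbb{Q}_{\ge 0}}a_\alpha q^\alpha\in\mathcal P$, the integer trace is $\operatorname{Tr}_{\mathbb Z}A(q):=\sum_{d\in\mathbb{Z}_{\ge 0}}a_d q^d\in\mathbb{Q}[[q]]$, i.e. all terms with nonintegral exponent are discarded. For $F,G\in\mathcal P$, write $F\geq_q G$ if and only if every coefficient of $\operatorname{Tr}_{\mathbb Z}(F-G)$ is nonnegative. For an integer $k\ge 0$ and a positive rational $r$, the generalized Gaussian binomial coefficient is the element of $\mathcal P$ $$\genfrac{[}{]}{0pt}{}{r+k}{k}_q=\frac{(1-q^{r+1})(1-q^{r+2})\cdots(1-q^{r+k})}{(1-q)(1-q^2)\cdots(1-q^k)};$$ for $r=m$ a positive integer it is the classical Gaussian binomial coefficient. *)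

theory Defs
  imports Complex_Main "HOL-Computational_Algebra.Formal_Power_Series"
begin

text \<open>
  Puiseux series with nonnegative exponents are given by their coefficient functions: the union
  over \<open>b \<ge> 1\<close> of the series all of whose exponents lie in \<open>(1/b) \<nat>\<close>.
\<close>

definition exps_in :: "nat \<Rightarrow> (rat \<Rightarrow> rat) \<Rightarrow> bool" where
  "exps_in b f \<longleftrightarrow> (\<forall>\<alpha>. f \<alpha> \<noteq> 0 \<longrightarrow> \<alpha> * of_nat b \<in> \<nat>)"

typedef puiseux = "{f :: rat \<Rightarrow> rat. \<exists>b\<ge>1. exps_in b f}"
  morphisms coeff Puiseux
  by (rule exI[of _ "\<lambda>_. 0"]) (auto simp: exps_in_def)

setup_lifting type_definition_puiseux

text \<open>
  The index set below is finite whenever \<open>f\<close> and \<open>g\<close> are Puiseux series, since \<open>\<beta>\<close> ranges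
  over elements of \<open>(1/b) \<nat>\<close> with \<open>\<beta> \<le> \<alpha>\<close>.
\<close>

definition cauchy_prod :: "(rat \<Rightarrow> rat) \<Rightarrow> (rat \<Rightarrow> rat) \<Rightarrow> rat \<Rightarrow> rat" where
  "cauchy_prod f g \<alpha> = (\<Sum>\<beta> | f \<beta> \<noteq> 0 \<and> g (\<alpha> - \<beta>) \<noteq> 0. f \<beta> * g (\<alpha> - \<beta>))"

text \<open>\<open>of_fps_root b F\<close> is the coefficient function of \<open>F(q\<^bsup>1/b\<^esup>)\<close>.\<close>

definition of_fps_root :: "nat \<Rightarrow> rat fps \<Rightarrow> rat \<Rightarrow> rat" where
  "of_fps_root b F \<alpha> = (if \<alpha> * of_nat b \<in> \<nat> then fps_nth F (nat \<lfloor>\<alpha> * of_nat b\<rfloor>) else 0)"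

lemma exps_in_of_fps_root: "exps_in b (of_fps_root b F)"
  by (auto simp: exps_in_def of_fps_root_def)

lemma of_fps_root_nth: "b \<ge> 1 \<Longrightarrow> of_fps_root b F (of_nat n / of_nat b) = fps_nth F n"
  by (auto simp: of_fps_root_def)

lemma exps_in_imp_of_fps_root:
  assumes "b \<ge> 1" "exps_in b f"
  shows "f = of_fps_root b (Abs_fps (\<lambda>n. f (of_nat n / of_nat b)))"
proof
  fix \<alpha>
  show "f \<alpha> = of_fps_root b (Abs_fps (\<lambda>n. f (of_nat n / of_nat b))) \<alpha>"
  proof (cases "\<alpha> * of_nat b \<in> \<nat>")
    case True
    then obtain n where "\<alpha> * of_nat b = of_nat n" by (auto elim: Nats_cases)
    with assms(1) have "\<alpha> = of_nat n / of_nat b" by (simp add: field_simps)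
    with assms(1) show ?thesis by (simp add: of_fps_root_nth)
  next
    case False
    with assms(2) show ?thesis by (auto simp: exps_in_def of_fps_root_def)
  qed
qed

lemma exps_in_mult:
  assumes "exps_in b f"
  shows "exps_in (b * c) f" "exps_in (c * b) f"
proof -
  have "\<alpha> * of_nat b * of_nat c \<in> \<nat>" if "f \<alpha> \<noteq> 0" for \<alpha>
    using assms that by (auto simp: exps_in_def intro!: Nats_mult)
  then show "exps_in (b * c) f" "exps_in (c * b) f"
    by (auto simp: exps_in_def mult_ac)
qed

lemma cauchy_prod_of_fps_root:
  assumes b: "b \<ge> 1"
  shows "cauchy_prod (of_fps_root b F) (of_fps_root b G) = of_fps_root b (F * G)"
proof
  fix \<alpha> :: rat
  define S where "S = {\<beta>. of_fps_root b F \<beta> \<noteq> 0 \<and> of_fps_root b G (\<alpha> - \<beta>) \<noteq> 0}"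
  have S: "\<beta> * of_nat b \<in> \<nat> \<and> (\<alpha> - \<beta>) * of_nat b \<in> \<nat>" if "\<beta> \<in> S" for \<beta>
    using that exps_in_of_fps_root by (auto simp: S_def exps_in_def)
  show "cauchy_prod (of_fps_root b F) (of_fps_root b G) \<alpha> = of_fps_root b (F * G) \<alpha>"
  proof (cases "\<alpha> * of_nat b \<in> \<nat>")
    case True
    then obtain n where "\<alpha> * of_nat b = of_nat n" by (auto elim: Nats_cases)
    with b have \<alpha>: "\<alpha> = of_nat n / of_nat b" by (simp add: field_simps)
    define h :: "nat \<Rightarrow> rat" where "h i = of_nat i / of_nat b" for i
    have inj: "inj_on h {0..n}" using b by (auto simp: inj_on_def h_def)
    have sub: "S \<subseteq> h ` {0..n}"
    proof
      fix \<beta> assume "\<beta> \<in> S"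
      from S[OF this] obtain i j where
        ij: "\<beta> * of_nat b = of_nat i" "(\<alpha> - \<beta>) * of_nat b = of_nat j"
        by (auto elim!: Nats_cases)
      have "\<alpha> * of_nat b = of_nat (i + j)"
        using ij by (simp add: left_diff_distrib)
      then have "(of_nat n :: rat) = of_nat (i + j)"
        using b by (simp add: \<alpha>)
      then have "n = i + j" by (simp only: of_nat_eq_iff)
      moreover have "\<beta> = h i" using ij(1) b by (simp add: h_def field_simps)
      ultimately show "\<beta> \<in> h ` {0..n}" by auto
    qed
    have "cauchy_prod (of_fps_root b F) (of_fps_root b G) \<alpha> =
        (\<Sum>\<beta>\<in>h ` {0..n}. of_fps_root b F \<beta> * of_fps_root b G (\<alpha> - \<beta>))"
      unfolding cauchy_prod_def S_def[symmetric]
      by (rule sum.mono_neutral_left) (use sub in \<open>auto simp: S_def\<close>)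
    also have "\<dots> = (\<Sum>i=0..n. of_fps_root b F (h i) * of_fps_root b G (\<alpha> - h i))"
      by (simp add: sum.reindex[OF inj])
    also have "\<dots> = (\<Sum>i=0..n. fps_nth F i * fps_nth G (n - i))"
    proof (rule sum.cong)
      fix i assume "i \<in> {0..n}"
      then have "\<alpha> - h i = of_nat (n - i) / of_nat b"
        by (simp add: \<alpha> h_def of_nat_diff diff_divide_distrib)
      then show "of_fps_root b F (h i) * of_fps_root b G (\<alpha> - h i) = fps_nth F i * fps_nth G (n - i)"
        using b by (simp add: h_def of_fps_root_nth)
    qed simp
    also have "\<dots> = of_fps_root b (F * G) \<alpha>"
      using b by (simp add: \<alpha> of_fps_root_nth fps_mult_nth)
    finally show ?thesis .
  next
    case False
    have "S = {}"
    proof (rule ccontr)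
      assume "S \<noteq> {}"
      then obtain \<beta> where "\<beta> \<in> S" by auto
      from S[OF this] have "\<beta> * of_nat b + (\<alpha> - \<beta>) * of_nat b \<in> \<nat>" by (intro Nats_add) auto
      with False show False by (simp add: algebra_simps)
    qed
    with False show ?thesis
      unfolding cauchy_prod_def S_def[symmetric] by (simp add: of_fps_root_def)
  qed
qed

lemma of_fps_root_add: "of_fps_root b (F + G) \<alpha> = of_fps_root b F \<alpha> + of_fps_root b G \<alpha>"
  by (simp add: of_fps_root_def)

text \<open>The monomial \<open>q\<^sup>r\<close> for \<open>r \<ge> 0\<close>; the value for negative \<open>r\<close> is \<open>0\<close> and irrelevant.\<close>

definition qpow_fun :: "rat \<Rightarrow> rat \<Rightarrow> rat" where
  "qpow_fun r \<alpha> = (if 0 \<le> r \<and> \<alpha> = r then 1 else 0)"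

lemma rat_times_denom:
  fixes r :: rat assumes "0 \<le> r"
  shows "\<exists>b\<ge>1. r * of_nat b \<in> \<nat>"
proof (cases r)
  case (Fract p d)
  have "r * of_nat (nat d) = of_nat (nat p)"
    using Fract assms by (simp add: Fract_of_int_quotient zero_le_divide_iff)
  with Fract show ?thesis by (intro exI[of _ "nat d"]) auto
qed

lift_definition qpow :: "rat \<Rightarrow> puiseux" is qpow_fun
proof -
  fix r :: rat
  show "\<exists>b\<ge>1. exps_in b (qpow_fun r)"
    using rat_times_denom[of r]
    by (cases "0 \<le> r") (auto simp: exps_in_def qpow_fun_def intro!: exI[of _ "1::nat"])
qed

instantiation puiseux :: comm_ring_1
begin

lift_definition zero_puiseux :: puiseux is "\<lambda>_. 0"
  by (auto simp: exps_in_def)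

lift_definition one_puiseux :: puiseux is "\<lambda>\<alpha>. if \<alpha> = 0 then 1 else 0"
  by (auto simp: exps_in_def)

lift_definition plus_puiseux :: "puiseux \<Rightarrow> puiseux \<Rightarrow> puiseux" is "\<lambda>f g \<alpha>. f \<alpha> + g \<alpha>"
proof -
  fix f g :: "rat \<Rightarrow> rat"
  assume "\<exists>b\<ge>1. exps_in b f" "\<exists>b\<ge>1. exps_in b g"
  then obtain b c where "b \<ge> 1" "c \<ge> 1" "exps_in b f" "exps_in c g" by blast
  then have "b * c \<ge> 1" "exps_in (b * c) f" "exps_in (b * c) g"
    by (auto intro: exps_in_mult simp: Suc_le_eq)
  moreover from this have "exps_in (b * c) (\<lambda>\<alpha>. f \<alpha> + g \<alpha>)"
    unfolding exps_in_def by (metis add_0)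
  ultimately show "\<exists>b\<ge>1. exps_in b (\<lambda>\<alpha>. f \<alpha> + g \<alpha>)"
    by blast
qed

lift_definition minus_puiseux :: "puiseux \<Rightarrow> puiseux \<Rightarrow> puiseux" is "\<lambda>f g \<alpha>. f \<alpha> - g \<alpha>"
proof -
  fix f g :: "rat \<Rightarrow> rat"
  assume "\<exists>b\<ge>1. exps_in b f" "\<exists>b\<ge>1. exps_in b g"
  then obtain b c where "b \<ge> 1" "c \<ge> 1" "exps_in b f" "exps_in c g" by blast
  then have "b * c \<ge> 1" "exps_in (b * c) f" "exps_in (b * c) g"
    by (auto intro: exps_in_mult simp: Suc_le_eq)
  moreover from this have "exps_in (b * c) (\<lambda>\<alpha>. f \<alpha> - g \<alpha>)"
    unfolding exps_in_def by (metis diff_0_right)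
  ultimately show "\<exists>b\<ge>1. exps_in b (\<lambda>\<alpha>. f \<alpha> - g \<alpha>)"
    by blast
qed

lift_definition uminus_puiseux :: "puiseux \<Rightarrow> puiseux" is "\<lambda>f \<alpha>. - f \<alpha>"
  by (auto simp: exps_in_def)

lift_definition times_puiseux :: "puiseux \<Rightarrow> puiseux \<Rightarrow> puiseux" is cauchy_prod
proof -
  fix f g :: "rat \<Rightarrow> rat"
  assume "\<exists>b\<ge>1. exps_in b f" "\<exists>b\<ge>1. exps_in b g"
  then obtain b c where "b \<ge> 1" "c \<ge> 1" "exps_in b f" "exps_in c g" by blast
  then have bc: "b * c \<ge> 1" "exps_in (b * c) f" "exps_in (b * c) g"
    by (auto intro: exps_in_mult simp: Suc_le_eq)
  then obtain F G where "f = of_fps_root (b * c) F" "g = of_fps_root (b * c) G"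
    using exps_in_imp_of_fps_root by blast
  then have "exps_in (b * c) (cauchy_prod f g)"
    using bc(1) by (simp add: cauchy_prod_of_fps_root exps_in_of_fps_root)
  with bc(1) show "\<exists>b\<ge>1. exps_in b (cauchy_prod f g)" by blast
qed

lemma common_denom:
  fixes x y z :: puiseux
  obtains b F G H where "b \<ge> 1"
    "coeff x = of_fps_root b F" "coeff y = of_fps_root b G" "coeff z = of_fps_root b H"
proof -
  obtain b c d where bcd: "b \<ge> 1" "c \<ge> 1" "d \<ge> 1"
    "exps_in b (coeff x)" "exps_in c (coeff y)" "exps_in d (coeff z)"
    using coeff[of x] coeff[of y] coeff[of z] by blast
  let ?e = "b * c * d"
  have "?e \<ge> 1" "exps_in ?e (coeff x)" "exps_in ?e (coeff y)" "exps_in ?e (coeff z)"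
    using bcd by (auto intro: exps_in_mult simp: Suc_le_eq)
  then show ?thesis
    using that exps_in_imp_of_fps_root by blast
qed

instance
proof
  fix x y z :: puiseux
  obtain b F G H where b: "b \<ge> 1" and
    eqs: "coeff x = of_fps_root b F" "coeff y = of_fps_root b G" "coeff z = of_fps_root b H"
    by (rule common_denom)
  show "x * y * z = x * (y * z)"
    by (simp add: coeff_inject[symmetric] times_puiseux.rep_eq eqs cauchy_prod_of_fps_root[OF b] mult.assoc)
  show "x * y = y * x"
    by (simp add: coeff_inject[symmetric] times_puiseux.rep_eq eqs cauchy_prod_of_fps_root[OF b] mult.commute)
  have "(\<lambda>\<alpha>. if \<alpha> = 0 then 1 else 0) = of_fps_root b 1"
    using b by (auto simp: of_fps_root_def fun_eq_iff elim!: Nats_cases)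
  then show "1 * x = x"
    by (simp add: coeff_inject[symmetric] times_puiseux.rep_eq one_puiseux.rep_eq eqs cauchy_prod_of_fps_root[OF b])
  have add: "(\<lambda>\<alpha>. of_fps_root b F \<alpha> + of_fps_root b G \<alpha>) = of_fps_root b (F + G)" for F G
    by (simp add: of_fps_root_add fun_eq_iff)
  show "(x + y) * z = x * z + y * z"
    by (simp add: coeff_inject[symmetric] times_puiseux.rep_eq plus_puiseux.rep_eq eqs add
        cauchy_prod_of_fps_root[OF b] distrib_right)
  show "(0::puiseux) \<noteq> 1"
    by transfer (auto simp: fun_eq_iff)
qed (transfer; simp add: fun_eq_iff)+

end

text \<open>
  Division by units only: \<open>inverse x\<close> is the multiplicative inverse if \<open>x\<close> has one, and \<open>0\<close>
  otherwise. The units are exactly the series with nonzero constant coefficient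
  (\<open>puiseux_unit_iff\<close> below).
\<close>

instantiation puiseux :: inverse
begin

definition inverse_puiseux :: "puiseux \<Rightarrow> puiseux" where
  "inverse_puiseux x = (if x dvd 1 then THE y. x * y = 1 else 0)"

definition divide_puiseux :: "puiseux \<Rightarrow> puiseux \<Rightarrow> puiseux" where
  "divide_puiseux x y = x * inverse y"

instance ..

end

lemma puiseux_inverse_unique:
  fixes x y :: puiseux
  assumes "x * y = 1"
  shows "inverse x = y"
proof -
  have "(THE y. x * y = 1) = y"
  proof (rule the_equality)
    show "x * y = 1" by (fact assms)
  next
    fix z assume "x * z = 1"
    then show "z = y" by (metis assms mult.left_commute mult.right_neutral)
  qed
  then show ?thesis using assms by (auto simp: inverse_puiseux_def dvd_def)
qed

lemma puiseux_right_inverse: "x dvd 1 \<Longrightarrow> x * inverse x = (1 :: puiseux)"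
  by (metis dvdE puiseux_inverse_unique)

lemma puiseux_divide_eq_iff: "y dvd 1 \<Longrightarrow> x / y = z \<longleftrightarrow> x = z * (y :: puiseux)"
  unfolding divide_puiseux_def
  by (metis mult.assoc mult.commute mult.right_neutral puiseux_right_inverse)

lemma coeff_0_mult: "coeff (x * y) 0 = coeff x 0 * coeff y 0"
proof -
  obtain b F G H where b: "b \<ge> 1" and
    eqs: "coeff x = of_fps_root b F" "coeff y = of_fps_root b G" "coeff y = of_fps_root b H"
    by (rule common_denom)
  have "of_fps_root b K 0 = fps_nth K 0" for K by (simp add: of_fps_root_def)
  then show ?thesis by (simp add: times_puiseux.rep_eq eqs(1,2) cauchy_prod_of_fps_root[OF b])
qed

lemma puiseux_unit_iff: "x dvd 1 \<longleftrightarrow> coeff x 0 \<noteq> 0"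
proof
  assume "x dvd 1"
  then obtain y where "1 = x * y" by (auto elim: dvdE)
  then have "coeff x 0 * coeff y 0 = coeff 1 0" by (metis coeff_0_mult)
  then show "coeff x 0 \<noteq> 0" by (auto simp: one_puiseux.rep_eq)
next
  assume nz: "coeff x 0 \<noteq> 0"
  obtain b F G H where b: "b \<ge> 1" and
    eqs: "coeff x = of_fps_root b F" "coeff x = of_fps_root b G" "coeff x = of_fps_root b H"
    by (rule common_denom)
  have F0: "fps_nth F 0 \<noteq> 0" using nz by (simp add: eqs(1) of_fps_root_def)
  define y where "y = Puiseux (of_fps_root b (inverse F))"
  have y: "coeff y = of_fps_root b (inverse F)"
    unfolding y_def using b exps_in_of_fps_root by (intro Puiseux_inverse) auto
  have "(\<lambda>\<alpha>. if \<alpha> = 0 then 1 else 0) = of_fps_root b 1"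
    using b by (auto simp: of_fps_root_def fun_eq_iff elim!: Nats_cases)
  then have "x * y = 1"
    using F0 by (simp add: coeff_inject[symmetric] times_puiseux.rep_eq one_puiseux.rep_eq eqs(1) y
        cauchy_prod_of_fps_root[OF b] inverse_mult_eq_1')
  then show "x dvd 1" by (metis dvdI)
qed

definition gauss_binomial :: "rat \<Rightarrow> nat \<Rightarrow> puiseux" where
  "gauss_binomial r k =
     (\<Prod>i=1..k. 1 - qpow (r + of_nat i)) / (\<Prod>i=1..k. 1 - qpow (of_nat i))"

lemma gauss_binomial_denom_unit: "(\<Prod>i=1..k. 1 - qpow (of_nat i)) dvd 1"
proof (induction k)
  case (Suc k)
  have "coeff (1 - qpow (of_nat (Suc k))) 0 = 1"
    by (simp add: minus_puiseux.rep_eq one_puiseux.rep_eq qpow.rep_eq qpow_fun_def del: of_nat_Suc)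
  with Suc show ?case by (simp add: puiseux_unit_iff coeff_0_mult del: of_nat_Suc)
qed simp

definition int_trace :: "puiseux \<Rightarrow> rat fps" where
  "int_trace A = Abs_fps (\<lambda>d. coeff A (of_nat d))"

definition ge_q :: "puiseux \<Rightarrow> puiseux \<Rightarrow> bool" (infix "\<ge>\<^sub>q" 50) where
  "F \<ge>\<^sub>q G \<longleftrightarrow> (\<forall>n. fps_nth (int_trace (F - G)) n \<ge> 0)"

end

theory Submission
  imports Defs
begin

text \<open>
  Write \<open>(q)\<^sub>k = (1 - q) \<dots> (1 - q\<^sup>k)\<close>. The series \<open>1 / (q)\<^sub>k\<close>, which counts partitions into at most
  \<open>k\<close> parts, separates the two sides.

  On the one hand it dominates the Gaussian binomial of every integer \<open>m \<ge> 0\<close>, which counts only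
  those partitions that also have largest part at most \<open>m\<close>. Algebraically, the Pascal recursion of
  the Gaussian binomials and the recursion \<open>1/(q)\<^sub>k = 1/(q)\<^sub>k\<^sub>-\<^sub>1 + q\<^sup>k/(q)\<^sub>k\<close> give this by induction
  (\<open>gauss_le_inverse_euler\<close>).

  On the other hand, expand \<open>(1 - q\<^bsup>3/2\<^esup>) \<dots> (1 - q\<^bsup>k+1/2\<^esup>)\<close> over the subsets of the factors. A subset
  of even size contributes a monomial with coefficient \<open>1\<close> and integral exponent, one of odd size a
  monomial with coefficient \<open>-1\<close> and nonintegral exponent. So the integer trace keeps only positive
  terms, among them the \<open>1\<close> of the empty subset; since the denominator \<open>(q)\<^sub>k\<close> has integral exponents,
  the trace of the whole quotient dominates \<open>1 / (q)\<^sub>k\<close> (\<open>inverse_euler_le_half_gauss\<close>).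

  The calculation is done for power series in \<open>x = q\<^bsup>1/2\<^esup>\<close>. There the sign rule says that
  substituting \<open>-x\<close> for \<open>x\<close> makes all coefficients nonnegative, and this property is stable under
  sums, products and geometric series; coefficients of even index do not feel the substitution.
\<close>

section \<open>Series with nonnegative coefficients up to a twist\<close>

text \<open>
  This says that \<open>F(s x)\<close> has nonnegative coefficients. The cases of interest are \<open>s = 1\<close> and
  \<open>s = -1\<close>; treating them together gives their common closure properties once.
\<close>

definition twist_nonneg :: "'a::linordered_field \<Rightarrow> 'a fps \<Rightarrow> bool" where
  "twist_nonneg s F \<longleftrightarrow> (\<forall>n. 0 \<le> s ^ n * fps_nth F n)"

lemma twist_nonneg_0: "twist_nonneg s 0"
  and twist_nonneg_1: "twist_nonneg s 1"
  by (auto simp: twist_nonneg_def)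

lemma twist_nonneg_X_power: "0 \<le> s ^ n \<Longrightarrow> twist_nonneg s (fps_X ^ n)"
  by (auto simp: twist_nonneg_def)

lemma twist_nonneg_neg_X_power: "s ^ n \<le> 0 \<Longrightarrow> twist_nonneg s (- (fps_X ^ n))"
  by (auto simp: twist_nonneg_def)

lemma twist_nonneg_add: "twist_nonneg s F \<Longrightarrow> twist_nonneg s G \<Longrightarrow> twist_nonneg s (F + G)"
  by (simp add: twist_nonneg_def distrib_left)

lemma twist_mult_nth:
  fixes s :: "'a::linordered_field"
  shows "s ^ n * fps_nth (F * G) n =
    (\<Sum>i=0..n. (s ^ i * fps_nth F i) * (s ^ (n - i) * fps_nth G (n - i)))"
  unfolding fps_mult_nth sum_distrib_left
proof (rule sum.cong)
  fix i assume "i \<in> {0..n}"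
  then have "s ^ n = s ^ i * s ^ (n - i)" by (simp flip: power_add)
  then show "s ^ n * (fps_nth F i * fps_nth G (n - i)) =
      (s ^ i * fps_nth F i) * (s ^ (n - i) * fps_nth G (n - i))"
    by simp
qed simp

lemma twist_nonneg_mult: "twist_nonneg s F \<Longrightarrow> twist_nonneg s G \<Longrightarrow> twist_nonneg s (F * G)"
  unfolding twist_nonneg_def[of s "F * G"] twist_mult_nth
  by (auto simp: twist_nonneg_def intro!: sum_nonneg)

text \<open>
  The inverse \<open>I\<close> satisfies \<open>I = 1 + M I\<close>. As \<open>M\<close> has no constant term, this expresses each
  coefficient of \<open>I\<close> by earlier ones with coefficients of the right sign.
\<close>

lemma twist_nonneg_inverse_one_minus:
  assumes M: "twist_nonneg s M" and M0: "fps_nth M 0 = 0"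
  shows "twist_nonneg s (inverse (1 - M))"
proof -
  define I where "I = inverse (1 - M)"
  have "I * (1 - M) = 1"
    unfolding I_def using M0 by (intro inverse_mult_eq_1) simp
  then have I: "I = 1 + M * I" by (simp add: algebra_simps)
  have "0 \<le> s ^ n * fps_nth I n" for n
  proof (induction n rule: less_induct)
    case (less n)
    have "0 \<le> s ^ n * fps_nth (M * I) n"
      unfolding twist_mult_nth
    proof (rule sum_nonneg)
      fix i assume "i \<in> {0..n}"
      show "0 \<le> (s ^ i * fps_nth M i) * (s ^ (n - i) * fps_nth I (n - i))"
      proof (cases "i = 0")
        case False
        with \<open>i \<in> {0..n}\<close> have "n - i < n" by simp
        with less M show ?thesis by (simp add: twist_nonneg_def)
      qed (simp add: M0)
    qed
    moreover have "fps_nth I n = fps_nth 1 n + fps_nth (M * I) n"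
      by (subst I) simp
    ultimately show ?case
      using twist_nonneg_1[of s] by (simp only: twist_nonneg_def distrib_left add_nonneg_nonneg)
  qed
  then show ?thesis by (simp add: twist_nonneg_def I_def)
qed

section \<open>Gaussian binomials as power series in a root of the variable\<close>

text \<open>With \<open>q = x\<^sup>b\<close>, these are the products \<open>(1 - q\<^bsup>r+1\<^esup>) \<dots> (1 - q\<^bsup>r+k\<^esup>)\<close> for \<open>r = a / b\<close>.\<close>

definition qpoch :: "nat \<Rightarrow> nat \<Rightarrow> nat \<Rightarrow> 'a::linordered_field fps" where
  "qpoch b a k = (\<Prod>i=1..k. 1 - fps_X ^ (a + b * i))"

definition fps_gauss :: "nat \<Rightarrow> nat \<Rightarrow> nat \<Rightarrow> 'a::linordered_field fps" where
  "fps_gauss b a k = qpoch b a k * inverse (qpoch b 0 k)"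

lemma qpoch_0: "qpoch b a 0 = 1"
  by (simp add: qpoch_def)

lemma qpoch_Suc: "qpoch b a (Suc k) = qpoch b a k * (1 - fps_X ^ (a + b * Suc k))"
  by (simp add: qpoch_def)

lemma qpoch_nth_0: "b \<ge> 1 \<Longrightarrow> fps_nth (qpoch b a k) 0 = 1"
  by (induction k) (simp_all add: qpoch_0 qpoch_Suc)

text \<open>Shifting the first parameter by \<open>b\<close> changes only the two end factors.\<close>

lemma qpoch_shift: "(1 - fps_X ^ (a + b)) * qpoch b (a + b) k = qpoch b a (Suc k)"
proof (induction k)
  case (Suc k)
  have "a + b + b * Suc k = a + b * Suc (Suc k)" by simp
  then show ?case
    by (simp only: qpoch_Suc[of b "a + b" k] qpoch_Suc[of b a "Suc k"] Suc.IH flip: mult.assoc)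
qed (simp add: qpoch_0 qpoch_Suc)

lemma inverse_qpoch_Suc:
  assumes "b \<ge> 1"
  shows "inverse (qpoch b 0 k) = (1 - fps_X ^ (b * Suc k)) * inverse (qpoch b 0 (Suc k))"
proof -
  have "inverse (1 - fps_X ^ (b * Suc k)) * (1 - fps_X ^ (b * Suc k)) = (1 :: 'a fps)"
    using assms by (intro inverse_mult_eq_1) simp
  then show ?thesis
    by (simp add: qpoch_Suc fps_inverse_mult mult_ac del: mult_Suc_right)
qed

text \<open>
  The Pascal recursion, from \<open>1 - q\<^bsup>m+k\<^esup> = (1 - q\<^sup>k) + q\<^sup>k (1 - q\<^sup>m)\<close> applied to the last factor of the
  numerator. In terms of partitions in a box it asks whether the largest possible number of parts is
  attained; if so, a column of the diagram can be removed.
\<close>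

lemma fps_gauss_pascal:
  assumes "b \<ge> 1"
  shows "(fps_gauss b (a + b) (Suc k) :: 'a::linordered_field fps) =
    fps_gauss b (a + b) k + fps_X ^ (b * Suc k) * fps_gauss b a (Suc k)"
proof -
  let ?x = "fps_X ^ (b * Suc k) :: 'a fps"
  have "(qpoch b (a + b) (Suc k) :: 'a fps) = qpoch b (a + b) k * (1 - ?x)
      + ?x * ((1 - fps_X ^ (a + b)) * qpoch b (a + b) k)"
    unfolding qpoch_Suc by (simp add: algebra_simps power_add)
  then have "(qpoch b (a + b) (Suc k) :: 'a fps) =
      qpoch b (a + b) k * (1 - ?x) + ?x * qpoch b a (Suc k)"
    by (simp only: qpoch_shift)
  then show ?thesis
    unfolding fps_gauss_def inverse_qpoch_Suc[OF assms, of k]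
    by (simp only: distrib_right mult.assoc)
qed

lemma twist_nonneg_inverse_euler:
  assumes "b \<ge> 1" "0 \<le> s ^ b"
  shows "twist_nonneg s (inverse (qpoch b 0 k))"
proof (induction k)
  case (Suc k)
  have "twist_nonneg s (inverse (1 - fps_X ^ (b * Suc k)))"
    using assms
    by (intro twist_nonneg_inverse_one_minus twist_nonneg_X_power)
      (simp_all add: power_mult del: mult_Suc_right)
  with Suc show ?case
    by (simp add: qpoch_Suc fps_inverse_mult twist_nonneg_mult del: mult_Suc_right)
qed (simp add: qpoch_0 twist_nonneg_1)

section \<open>Comparison with the inverse Euler product\<close>

text \<open>
  Both sides obey recursions of the same shape in \<open>k\<close>. For \<open>m \<ge> 1\<close>, subtracting them writes the
  difference as that for \<open>(m, k - 1)\<close> plus a power of \<open>q\<close> times that for \<open>(m - 1, k)\<close>.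
\<close>

lemma gauss_le_inverse_euler:
  fixes b m k :: nat
  assumes "b \<ge> 1"
  shows "twist_nonneg 1 (inverse (qpoch b 0 k) - fps_gauss b (b * m) k :: 'a::linordered_field fps)"
proof (induction k arbitrary: m)
  case 0
  show ?case by (simp add: fps_gauss_def qpoch_0 twist_nonneg_0)
next
  case (Suc k)
  note smaller_k = Suc.IH
  let ?H = "\<lambda>k. inverse (qpoch b 0 k) :: 'a fps"
  let ?x = "fps_X ^ (b * Suc k) :: 'a fps"
  have x: "twist_nonneg 1 ?x" by (rule twist_nonneg_X_power) simp
  have H: "?H (Suc k) = ?H k + ?x * ?H (Suc k)"
    using inverse_qpoch_Suc[OF assms, of k, where 'a = 'a] by (simp add: algebra_simps)
  show ?case
  proof (induction m)
    case 0
    \<comment> \<open>For \<open>m = 0\<close> the Gaussian binomial is \<open>1\<close>, for every \<open>k\<close>.\<close>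
    have one: "fps_gauss b (b * 0) j = (1 :: 'a fps)" for j
      unfolding fps_gauss_def mult_0_right
      using assms inverse_mult_eq_1'[of "qpoch b 0 j"] by (simp add: qpoch_nth_0)
    have "?H (Suc k) - fps_gauss b (b * 0) (Suc k) =
        (?H k - fps_gauss b (b * 0) k) + ?x * ?H (Suc k)"
      by (subst H) (simp only: one, simp)
    moreover have "twist_nonneg 1 (?H (Suc k))"
      using assms by (intro twist_nonneg_inverse_euler) simp_all
    ultimately show ?case
      using smaller_k[of 0] x by (simp only: twist_nonneg_add twist_nonneg_mult)
  next
    case (Suc m)
    have "?H (Suc k) - fps_gauss b (b * Suc m) (Suc k) =
        (?H k - fps_gauss b (b * Suc m) k) + ?x * (?H (Suc k) - fps_gauss b (b * m) (Suc k))"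
      using fps_gauss_pascal[OF assms, of "b * m" k, where 'a = 'a]
      by (subst H) (simp add: algebra_simps)
    then show ?case
      using Suc.IH smaller_k[of "Suc m"] x
      by (simp only: twist_nonneg_add twist_nonneg_mult)
  qed
qed

text \<open>
  All exponents \<open>2 i + 1\<close> are odd, so every factor of the numerator turns into \<open>1 + x\<^bsup>2i+1\<^esup>\<close> under
  the twist by \<open>-1\<close>, and the product exceeds its constant term \<open>1\<close> by nonnegative terms.
\<close>

lemma inverse_euler_le_half_gauss:
  "twist_nonneg (- 1) (fps_gauss 2 1 k - inverse (qpoch 2 0 k) :: 'a::linordered_field fps)"
proof -
  have "twist_nonneg (- 1) (qpoch 2 1 k - 1 :: 'a fps)"
  proof (induction k)
    case (Suc k)
    let ?y = "- (fps_X ^ (1 + 2 * Suc k)) :: 'a fps"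
    have y: "twist_nonneg (- 1) ?y" by (rule twist_nonneg_neg_X_power) simp
    have "qpoch 2 1 (Suc k) - 1 = (qpoch 2 1 k - 1) * (1 + ?y) + ?y"
      unfolding qpoch_Suc by (simp add: algebra_simps)
    with Suc y show ?case
      by (simp only: twist_nonneg_add twist_nonneg_mult twist_nonneg_1)
  qed (simp add: qpoch_0 twist_nonneg_0)
  then have "twist_nonneg (- 1) ((qpoch 2 1 k - 1) * inverse (qpoch 2 0 k) :: 'a fps)"
    by (intro twist_nonneg_mult twist_nonneg_inverse_euler) simp_all
  then show ?thesis by (simp add: fps_gauss_def algebra_simps)
qed

section \<open>Substituting a root of the variable\<close>

definition subst_root :: "nat \<Rightarrow> rat fps \<Rightarrow> puiseux" where
  "subst_root b F = Puiseux (of_fps_root b F)"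

lemma coeff_subst_root: "b \<ge> 1 \<Longrightarrow> coeff (subst_root b F) = of_fps_root b F"
  unfolding subst_root_def using exps_in_of_fps_root by (intro Puiseux_inverse) auto

lemma subst_root_mult: "b \<ge> 1 \<Longrightarrow> subst_root b (F * G) = subst_root b F * subst_root b G"
  by (simp add: coeff_inject[symmetric] times_puiseux.rep_eq coeff_subst_root
      cauchy_prod_of_fps_root)

lemma subst_root_diff: "b \<ge> 1 \<Longrightarrow> subst_root b (F - G) = subst_root b F - subst_root b G"
  by (simp add: coeff_inject[symmetric] minus_puiseux.rep_eq coeff_subst_root fun_eq_iff
      of_fps_root_def)

lemma subst_root_X_power:
  assumes "b \<ge> 1"
  shows "subst_root b (fps_X ^ n) = qpow (of_nat n / of_nat b)"
  using assms
  by (auto simp: coeff_inject[symmetric] qpow.rep_eq qpow_fun_def coeff_subst_root fun_eq_iff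
      of_fps_root_def field_simps elim!: Nats_cases)

lemma subst_root_1: "b \<ge> 1 \<Longrightarrow> subst_root b 1 = 1"
  using subst_root_X_power[of b 0]
  by (simp add: coeff_inject[symmetric] qpow.rep_eq qpow_fun_def one_puiseux.rep_eq fun_eq_iff)

lemma subst_root_qpoch:
  assumes "b \<ge> 1"
  shows "subst_root b (qpoch b a k) = (\<Prod>i=1..k. 1 - qpow (of_nat a / of_nat b + of_nat i))"
proof (induction k)
  case (Suc k)
  have "of_nat (a + b * Suc k) / of_nat b = (of_nat a / of_nat b + of_nat (Suc k) :: rat)"
    using assms by (simp add: field_simps)
  with Suc assms show ?case
    by (simp add: qpoch_Suc subst_root_mult subst_root_diff subst_root_1 subst_root_X_power
        del: of_nat_Suc of_nat_add of_nat_mult mult_Suc_right)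
qed (use assms in \<open>simp add: qpoch_0 subst_root_1\<close>)

lemma gauss_binomial_eq_subst_root:
  assumes "b \<ge> 1"
  shows "gauss_binomial (of_nat a / of_nat b) k = subst_root b (fps_gauss b a k)"
proof -
  have "fps_gauss b a k * qpoch b 0 k = (qpoch b a k :: rat fps)"
    using assms inverse_mult_eq_1[of "qpoch b 0 k :: rat fps"]
    by (simp add: fps_gauss_def qpoch_nth_0 mult.assoc)
  then have "subst_root b (qpoch b a k) = subst_root b (fps_gauss b a k) * subst_root b (qpoch b 0 k)"
    using assms by (simp flip: subst_root_mult)
  then show ?thesis
    unfolding gauss_binomial_def puiseux_divide_eq_iff[OF gauss_binomial_denom_unit]
    using assms by (simp add: subst_root_qpoch)
qed

lemma int_trace_subst_root_nth:
  "b \<ge> 1 \<Longrightarrow> fps_nth (int_trace (subst_root b F)) n = fps_nth F (b * n)"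
  using of_fps_root_nth[of b F "b * n"] by (simp add: int_trace_def coeff_subst_root)

theorem proposition5p2:
  fixes m k :: nat
  assumes "m \<ge> 1" and "k \<ge> 1"
  shows "gauss_binomial (1 / 2) k \<ge>\<^sub>q gauss_binomial (of_nat m) k"
proof -
  let ?H = "inverse (qpoch 2 0 k) :: rat fps"
  have half: "gauss_binomial (1 / 2) k = subst_root 2 (fps_gauss 2 1 k)"
    using gauss_binomial_eq_subst_root[of 2 1 k] by simp
  have int: "gauss_binomial (of_nat m) k = subst_root 2 (fps_gauss 2 (2 * m) k)"
    using gauss_binomial_eq_subst_root[of 2 "2 * m" k] by simp
  have "0 \<le> fps_nth (fps_gauss 2 1 k - fps_gauss 2 (2 * m) k :: rat fps) (2 * n)" for n
  proof -
    have "0 \<le> (- 1) ^ (2 * n) * fps_nth (fps_gauss 2 1 k - ?H) (2 * n)"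
      using inverse_euler_le_half_gauss[of k, where 'a = rat] unfolding twist_nonneg_def by blast
    moreover have "0 \<le> 1 ^ (2 * n) * fps_nth (?H - fps_gauss 2 (2 * m) k) (2 * n)"
      using gauss_le_inverse_euler[of 2 k m, where 'a = rat] unfolding twist_nonneg_def by simp
    ultimately show ?thesis by simp
  qed
  then show ?thesis
    by (simp add: ge_q_def half int int_trace_subst_root_nth flip: subst_root_diff)
qed

end
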